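(* Let $N\ge2$. For the linear "focusing eigenvalue problem" $$-\frac{1}{y^{N-1}}\Big[y^{N-1}\Big(\frac{1}{y^{N-1}}(y^{N-1}f')'\Big)'\Big]'-\frac14\,y f'+\alpha f=0\quad(y>0),\qquad f'(0)=f'''(0)=0,\qquad \alpha>0,$$ there exists not more than a countable set of admissible eigenvalues $\{\alpha_k\}_{k\ge1}$, given by $$\alpha_k=\frac k2,\qquad k=1,2,3,\dots;$$ that is, every admissible eigenvalue belongs to $\{k/2: k=1,2,3,\dots\}$.
   Context: A value $\alpha>0$ is an admissible eigenvalue if the ODE has a nontrivial solution $f$ on $(0,\infty)$, smooth up to $y=0$ with the symmetry conditions $f'(0)=f'''(0)=0$ (so that $f(|x|)$ is a smooth radial function on $\mathbb{R}^N$), having minimal growth at infinity: $f(y)=C y^{4\alpha}(1+o(1))+D e^{a_3y^{4/3}}(1+o(1))$ as $y\to+\infty$ with $C,D\in\mathbb{R}$ and $a_3=-\frac34\,4^{-1/3}<0$ (as opposed to the maximal, exponentially growing oscillatory behaviour $y^{-\frac23(N+2\alpha)}e^{c_0y^{4/3}}[C_1\cos(c_1y^{4/3})+C_2\sin(c_1y^{4/3})]$ with $c_0\pm i c_1=\frac34 4^{-1/3}(\frac12\pm i\frac{\sqrt3}{2})$, whose coefficients $C_1,C_2$ must both vanish). The ODE arises from substituting $u_*(r,t)=(-t)^{\alpha}f(r/(-t)^{1/4})$, $t<0$, $r=|x|$, into the bi-harmonic parabolic equation $u_t=-\Delta^2u$ in $\mathbb{R}^N\times(-\infty,0)$; minimal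 growth is what gives the finite trace $u_*(r,t)\to Cr^{4\alpha}$ as $t\to0^-$. *)

theory Defs
  imports "HOL-Analysis.Analysis"
begin

text \<open>
  Derivative on the closed half-line: two-sided at \<open>y > 0\<close>, one-sided at \<open>y = 0\<close>.  Profiles are
  total functions, but only their values on \<open>[0, \<infinity>)\<close> matter.
\<close>

definition half_line_deriv :: "(real \<Rightarrow> real) \<Rightarrow> real \<Rightarrow> real" where
  "half_line_deriv f y = vector_derivative f (at y within {0..})"

definition smooth_half_line :: "(real \<Rightarrow> real) \<Rightarrow> bool" where
  "smooth_half_line f \<longleftrightarrow> (\<forall>k. (half_line_deriv ^^ k) f differentiable_on {0..})"

text \<open>
  The Laplacian of \<open>f(|x|)\<close> on \<open>\<real>\<^sup>N\<close> away from the origin, in divergence form; only values at \<open>y > 0\<close>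
  are meaningful.
\<close>

definition radial_laplacian :: "nat \<Rightarrow> (real \<Rightarrow> real) \<Rightarrow> real \<Rightarrow> real" where
  "radial_laplacian N f y = 1 / y ^ (N - 1) * deriv (\<lambda>s. s ^ (N - 1) * deriv f s) y"

definition focusing_ode :: "nat \<Rightarrow> real \<Rightarrow> (real \<Rightarrow> real) \<Rightarrow> bool" where
  "focusing_ode N \<alpha> f \<longleftrightarrow>
    (\<forall>y>0. - radial_laplacian N (radial_laplacian N f) y - 1/4 * y * deriv f y + \<alpha> * f y = 0)"

definition a3 :: real where
  "a3 = - (3/4) * 4 powr (- (1/3))"

text \<open>
  The functions \<open>\<epsilon>\<close> and \<open>\<delta>\<close> are the two \<open>o(1)\<close> terms.  Either coefficient may vanish.
\<close>

definition minimal_growth :: "real \<Rightarrow> (real \<Rightarrow> real) \<Rightarrow> bool" where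
  "minimal_growth \<alpha> f \<longleftrightarrow>
    (\<exists>(C::real) (D::real) \<epsilon> \<delta>. (\<epsilon> \<longlongrightarrow> (0::real)) at_top \<and> (\<delta> \<longlongrightarrow> (0::real)) at_top \<and>
      (\<forall>\<^sub>F y in at_top. f y = C * y powr (4 * \<alpha>) * (1 + \<epsilon> y)
                            + D * exp (a3 * y powr (4/3)) * (1 + \<delta> y)))"

definition admissible_eigenvalue :: "nat \<Rightarrow> real \<Rightarrow> bool" where
  "admissible_eigenvalue N \<alpha> \<longleftrightarrow> \<alpha> > 0 \<and>
    (\<exists>f. smooth_half_line f \<and> (\<exists>y>0. f y \<noteq> 0) \<and>
         half_line_deriv f 0 = 0 \<and> (half_line_deriv ^^ 3) f 0 = 0 \<and>
         focusing_ode N \<alpha> f \<and> minimal_growth \<alpha> f)"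

end

theory Submission
  imports Defs
begin

text \<open>
  The point is a Liouville argument.  Write \<open>\<Delta>\<close> for the radial Laplacian, so that the equation is
  \<open>\<Delta>\<^sup>2 f = \<alpha> f - y f' / 4\<close>.  Since \<open>\<Delta>\<close> lowers homogeneity by two, it commutes with the operator up to
  a shift: if \<open>f\<close> solves the equation with eigenvalue \<open>\<alpha>\<close>, then \<open>\<Delta> f\<close> solves it with \<open>\<alpha> - 1/2\<close>
  (\<open>radial_system_laplacian\<close>).  Two facts about a solution \<open>g\<close> with eigenvalue \<open>\<beta>\<close>, of polynomial
  growth in mean square, then give the theorem.

  First, the growth bound passes from \<open>g\<close> to \<open>\<Delta> g\<close>, and if \<open>\<beta> + N/8 \<le> -1\<close> then \<open>g = 0\<close>
  (\<open>tempered_laplacian\<close>, \<open>tempered_negative_imp_zero\<close>).  Both come from one weighted energy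
  inequality, \<open>energy_estimate\<close>: testing the equation with \<open>g\<close> times a cutoff \<open>w\<close> at radius \<open>R\<close>
  yields, with respect to the measure \<open>y\<^bsup>N-1\<^esup> dy\<close>,
  \<open>1/4 \<integral> (\<Delta>g)\<^sup>2 w \<le> (\<beta> + N/8) \<integral> g\<^sup>2 w + C R\<^bsup>-4\<^esup> \<integral> g\<^sup>2\<close>.
  The drift \<open>y g' / 4\<close> produces the \<open>N/8\<close> and a term \<open>y w' / 8 \<le> 0\<close>.  Growth of \<open>\<Delta> g\<close> is read off
  directly.  When \<open>\<beta> + N/8\<close> is negative, its term moves to the left and bounds the mass in the
  ball of radius \<open>R/2\<close> by \<open>C R\<^bsup>-4\<^esup>\<close> times the mass in the ball of radius \<open>R\<close>; iterating this beats
  every polynomial.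

  Second, if \<open>\<Delta> g = 0\<close> but \<open>g \<noteq> 0\<close>, then \<open>\<beta> = 0\<close> (\<open>harmonic_imp_eigenvalue_zero\<close>).

  Applying \<open>\<Delta>\<close> repeatedly to \<open>f\<close> lowers the eigenvalue by \<open>1/2\<close> each time, so by the first fact
  some iterate is the last nonzero one, and by the second its eigenvalue is \<open>0\<close>.  Hence \<open>\<alpha>\<close> is half
  the number of steps.  Minimal growth enters through the polynomial bound on \<open>f\<close> that it implies,
  and the conditions at \<open>y = 0\<close> through the continuity of \<open>\<Delta> f\<close> and \<open>(\<Delta> f)'\<close> up to the origin.
\<close>

section \<open>The equation as a first-order system\<close>

text \<open>
  Here \<open>p = g'\<close>, \<open>h = \<Delta> g\<close>, \<open>q = h'\<close>, and the last line is \<open>\<Delta> h = \<beta> g - y g' / 4\<close>.  Carrying the four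
  functions explicitly makes the class closed under \<open>\<Delta>\<close> without any bookkeeping of higher
  derivatives.  Their continuity up to \<open>y = 0\<close> is what makes the boundary terms of the integrations
  by parts vanish there.
\<close>

definition radial_system ::
  "nat \<Rightarrow> real \<Rightarrow> (real \<Rightarrow> real) \<Rightarrow> (real \<Rightarrow> real) \<Rightarrow> (real \<Rightarrow> real) \<Rightarrow> (real \<Rightarrow> real) \<Rightarrow> bool" where
  "radial_system N \<beta> g p h q \<longleftrightarrow>
    continuous_on {0..} g \<and> continuous_on {0..} p \<and> continuous_on {0..} h \<and> continuous_on {0..} q \<and>
    (\<forall>y>0. (g has_real_derivative p y) (at y) \<and>
           (p has_real_derivative h y - (real N - 1) / y * p y) (at y) \<and>
           (h has_real_derivative q y) (at y) \<and>
           (q has_real_derivative \<beta> * g y - y / 4 * p y - (real N - 1) / y * q y) (at y))"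

lemma radial_systemD:
  assumes "radial_system N \<beta> g p h q"
  shows "continuous_on {0..} g" "continuous_on {0..} p"
    "continuous_on {0..} h" "continuous_on {0..} q"
    "\<And>y. y > 0 \<Longrightarrow> (g has_real_derivative p y) (at y)"
    "\<And>y. y > 0 \<Longrightarrow> (p has_real_derivative h y - (real N - 1) / y * p y) (at y)"
    "\<And>y. y > 0 \<Longrightarrow> (h has_real_derivative q y) (at y)"
    "\<And>y. y > 0 \<Longrightarrow> (q has_real_derivative \<beta> * g y - y / 4 * p y - (real N - 1) / y * q y) (at y)"
  using assms unfolding radial_system_def by blast+

text \<open>
  The commutator of \<open>\<Delta>\<close> with \<open>y d/dy\<close> is \<open>2 \<Delta>\<close>, so the drift \<open>- y g' / 4\<close> contributes the shift by \<open>1/2\<close>.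
  The fourth component below is the derivative of the third, rewritten so that it contains no
  division by \<open>y\<close> and is visibly continuous at the origin.
\<close>

lemma radial_system_laplacian:
  assumes "radial_system N \<beta> g p h q"
  shows "radial_system N (\<beta> - 1/2) h q (\<lambda>y. \<beta> * g y - y / 4 * p y)
    (\<lambda>y. (\<beta> + (real N - 2) / 4) * p y - y / 4 * h y)"
proof -
  note S = radial_systemD[OF assms]
  have 1: "((\<lambda>y. \<beta> * g y - y / 4 * p y) has_real_derivative
      (\<beta> + (real N - 2) / 4) * p y - y / 4 * h y) (at y)" if "y > 0" for y
    using that by (auto intro!: derivative_eq_intros S simp: field_simps)
  have 2: "((\<lambda>y. (\<beta> + (real N - 2) / 4) * p y - y / 4 * h y) has_real_derivative
      (\<beta> - 1/2) * h y - y / 4 * q y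
      - (real N - 1) / y * ((\<beta> + (real N - 2) / 4) * p y - y / 4 * h y)) (at y)" if "y > 0" for y
    using that by (auto intro!: derivative_eq_intros S simp: field_simps)
  have 3: "(q has_real_derivative (\<beta> * g y - y / 4 * p y) - (real N - 1) / y * q y) (at y)"
    if "y > 0" for y
    using S(8)[OF that] by simp
  show ?thesis
    unfolding radial_system_def
    using 1 2 3 S by (auto intro!: continuous_intros)
qed

section \<open>The weighted energy inequality\<close>

lemma DERIV_radial_weight:
  assumes "N \<ge> 1" "y > 0"
  shows "((\<lambda>s. s ^ (N - 1)) has_real_derivative (real N - 1) / y * y ^ (N - 1)) (at y)"
proof (cases "N = 1")
  case False
  then have "y * y ^ (N - 2) = y ^ (N - 1)"
    using assms by (simp add: Suc_diff_Suc numeral_2_eq_2 flip: power_Suc)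
  then show ?thesis
    using assms by (auto intro!: derivative_eq_intros simp: field_simps numeral_2_eq_2)
qed simp

text \<open>
  The fourth power makes the cutoff and its first derivative vanish at \<open>y = R\<close>, which kills the
  boundary terms there, and bounds the square of its Laplacian by a multiple of \<open>R\<^bsup>-4\<^esup>\<close> times the
  cutoff itself.
\<close>

definition cutoff :: "real \<Rightarrow> real \<Rightarrow> real" where
  "cutoff R y = (1 - y\<^sup>2 / R\<^sup>2) ^ 4"

definition mass :: "nat \<Rightarrow> (real \<Rightarrow> real) \<Rightarrow> real \<Rightarrow> real" where
  "mass N g R = integral {0..R} (\<lambda>y. y ^ (N - 1) * (g y)\<^sup>2)"

text \<open>
  The summands are the multiples of \<open>R\<^bsup>-4\<^esup> g\<^sup>2\<close> that \<open>energy_pointwise\<close> spends on completing squares in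
  its cross terms \<open>h g \<Delta>w\<close>, \<open>h g v\<close> and \<open>p g v'\<close>, in this order.
\<close>

definition error_const :: "nat \<Rightarrow> real" where
  "error_const N = (8 * real N + 48)\<^sup>2 + 512\<^sup>2 + 4096"

text \<open>
  Here \<open>\<rho> = R\<^bsup>-2\<^esup>\<close>, \<open>w = a\<^sup>4\<close> is the cutoff and \<open>v = \<rho>\<^sup>2 y\<^sup>2 a\<^sup>2\<close> an auxiliary weight with
  \<open>w'\<^sup>2 = 64 v w\<close>.  The first two lines on the left form the integrand left over after testing the
  equation with \<open>g w\<close>; the last two are \<open>-512\<close> times \<open>(y\<^bsup>N-1\<^esup> p g v)' / y\<^bsup>N-1\<^esup>\<close>, which integrates to
  zero against \<open>y\<^bsup>N-1\<^esup> dy\<close> and supplies the negative multiple of \<open>p\<^sup>2 v\<close> needed to absorb every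
  term in \<open>p\<close>.  Each of the four cross terms is then estimated by completing a square; the three
  that contain \<open>h\<close> cost a quarter of \<open>h\<^sup>2 w\<close> each, which leaves the last quarter.  The two that
  contain \<open>p\<close> cost \<open>256 p\<^sup>2 v\<close> each, whence the factor \<open>512\<close>.
\<close>

lemma energy_pointwise:
  fixes g p h y \<rho> \<gamma> :: real and N :: nat
  defines "a \<equiv> 1 - \<rho> * y\<^sup>2"
  assumes \<rho>: "\<rho> > 0" and y: "0 \<le> y" and le: "\<rho> * y\<^sup>2 \<le> 1"
  shows "(\<gamma> * a ^ 4 - \<rho> * y\<^sup>2 * a ^ 3) * g\<^sup>2 - h\<^sup>2 * a ^ 4 + 16 * \<rho> * y * a ^ 3 * (h * p)
      - h * g * (\<rho> * a\<^sup>2 * (48 * \<rho> * y\<^sup>2 - 8 * real N * a))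
      - 512 * (h * g * (\<rho>\<^sup>2 * y\<^sup>2 * a\<^sup>2) + p\<^sup>2 * (\<rho>\<^sup>2 * y\<^sup>2 * a\<^sup>2)
          + p * g * (2 * \<rho>\<^sup>2 * y * a * (a - 2 * \<rho> * y\<^sup>2)))
    \<le> \<gamma> * (g\<^sup>2 * a ^ 4) - h\<^sup>2 * a ^ 4 / 4 + error_const N * \<rho>\<^sup>2 * g\<^sup>2"
proof -
  define t where "t = \<rho> * y\<^sup>2"
  define k where "k = 48 * t - 8 * real N * a"
  have t: "0 \<le> t" "t \<le> 1" using le \<rho> by (auto simp: t_def)
  have a: "a = 1 - t" "0 \<le> a" "a \<le> 1" using t by (auto simp: a_def t_def)
  have "real N * a \<le> real N * 1" by (intro mult_left_mono a) auto
  moreover have "real N * a \<ge> 0" using a by simp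
  ultimately have "\<bar>k\<bar> \<le> 8 * real N + 48"
    unfolding k_def abs_le_iff using t by linarith
  then have k2: "k\<^sup>2 \<le> (8 * real N + 48)\<^sup>2" using abs_le_square_iff by fastforce
  have t2: "t\<^sup>2 \<le> 1" using t by (simp add: power_le_one)
  have "\<bar>a - 2 * t\<bar> \<le> 2" using a t by auto
  then have at2: "(a - 2 * t)\<^sup>2 \<le> 4" using abs_le_square_iff[of "a - 2 * t" 2] by simp
  \<comment> \<open>The four cross terms: \<open>h p w'\<close>, \<open>h g \<Delta>w\<close>, \<open>h g v\<close> and \<open>p g v'\<close>.\<close>
  have s1: "16 * \<rho> * y * a ^ 3 * (h * p) \<le> h\<^sup>2 * a ^ 4 / 4 + 256 * (p\<^sup>2 * (\<rho>\<^sup>2 * y\<^sup>2 * a\<^sup>2))"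
    using zero_le_power2[of "h * a\<^sup>2 / 2 - 16 * p * \<rho> * y * a"]
    by (simp add: power2_eq_square algebra_simps power3_eq_cube power4_eq_xxxx)
  have s2: "- (h * g * (\<rho> * a\<^sup>2 * k)) \<le> h\<^sup>2 * a ^ 4 / 4 + k\<^sup>2 * (\<rho>\<^sup>2 * g\<^sup>2)"
    using zero_le_power2[of "h * a\<^sup>2 / 2 + \<rho> * k * g"]
    by (simp add: power2_eq_square algebra_simps power3_eq_cube power4_eq_xxxx)
  have s3: "- 512 * (h * g * (\<rho> * t * a\<^sup>2)) \<le> h\<^sup>2 * a ^ 4 / 4 + 262144 * (t\<^sup>2 * (\<rho>\<^sup>2 * g\<^sup>2))"
    using zero_le_power2[of "h * a\<^sup>2 / 2 + 512 * \<rho> * t * g"]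
    by (simp add: power2_eq_square algebra_simps power3_eq_cube power4_eq_xxxx)
  have s4: "- 512 * (p * g * (2 * \<rho>\<^sup>2 * y * a * (a - 2 * t)))
      \<le> 256 * (p\<^sup>2 * (\<rho>\<^sup>2 * y\<^sup>2 * a\<^sup>2)) + 1024 * ((a - 2 * t)\<^sup>2 * (\<rho>\<^sup>2 * g\<^sup>2))"
  proof -
    define b where "b = a - 2 * t"
    show ?thesis unfolding b_def[symmetric]
      using zero_le_power2[of "16 * p * \<rho> * y * a + 32 * \<rho> * b * g"]
      by (simp add: power2_eq_square algebra_simps)
  qed
  have pos: "0 \<le> \<rho>\<^sup>2 * g\<^sup>2" by simp
  have e1: "k\<^sup>2 * (\<rho>\<^sup>2 * g\<^sup>2) \<le> (8 * real N + 48)\<^sup>2 * (\<rho>\<^sup>2 * g\<^sup>2)"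
    and e2: "t\<^sup>2 * (\<rho>\<^sup>2 * g\<^sup>2) \<le> 1 * (\<rho>\<^sup>2 * g\<^sup>2)"
    and e3: "(a - 2 * t)\<^sup>2 * (\<rho>\<^sup>2 * g\<^sup>2) \<le> 4 * (\<rho>\<^sup>2 * g\<^sup>2)"
    by (intro mult_right_mono k2 t2 at2 pos)+
  have "0 \<le> t * a ^ 3 * g\<^sup>2" using t a by simp
  moreover have "\<rho>\<^sup>2 * y\<^sup>2 = \<rho> * t" by (simp add: t_def power2_eq_square)
  moreover define c where "c = (8 * real N + 48)\<^sup>2"
  moreover have "error_const N * \<rho>\<^sup>2 * g\<^sup>2 = c * (\<rho>\<^sup>2 * g\<^sup>2)
      + 262144 * (\<rho>\<^sup>2 * g\<^sup>2) + 4096 * (\<rho>\<^sup>2 * g\<^sup>2)"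
    by (simp add: error_const_def c_def algebra_simps)
  moreover have "h * g * (\<rho> * a\<^sup>2 * (48 * \<rho> * y\<^sup>2 - 8 * real N * a)) = h * g * (\<rho> * a\<^sup>2 * k)"
    "p * g * (2 * \<rho>\<^sup>2 * y * a * (a - 2 * \<rho> * y\<^sup>2)) = p * g * (2 * \<rho>\<^sup>2 * y * a * (a - 2 * t))"
    "(\<gamma> * a ^ 4 - \<rho> * y\<^sup>2 * a ^ 3) * g\<^sup>2 = \<gamma> * (g\<^sup>2 * a ^ 4) - t * a ^ 3 * g\<^sup>2"
    by (simp_all add: k_def t_def algebra_simps)
  ultimately show ?thesis
    using s1 s2 s3 s4 e1[folded c_def] e2 e3 by (simp only: distrib_left)
qed

text \<open>
  The function \<open>B\<close> in the proof collects the boundary terms of all integrations by parts, and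
  \<open>y\<^bsup>N-1\<^esup> E\<close> is its derivative.  It vanishes at \<open>R\<close> because of the cutoff and at \<open>0\<close> because
  \<open>N \<ge> 2\<close>, so the integral of \<open>y\<^bsup>N-1\<^esup> E\<close> is zero, and the pointwise bound on \<open>E\<close> becomes the inequality.
\<close>

lemma energy_estimate:
  assumes S: "radial_system N \<beta> g p h q" and N: "N \<ge> 2" and R: "R > 0"
  shows "integral {0..R} (\<lambda>y. y ^ (N - 1) * ((h y)\<^sup>2 * cutoff R y)) / 4
    \<le> (\<beta> + real N / 8) * integral {0..R} (\<lambda>y. y ^ (N - 1) * ((g y)\<^sup>2 * cutoff R y))
      + error_const N / R ^ 4 * mass N g R"
proof -
  define \<rho> where "\<rho> = 1 / R\<^sup>2"
  note S' = radial_systemD[OF S]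
  define a where "a y = 1 - \<rho> * y\<^sup>2" for y
  have \<rho>: "\<rho> > 0" using R by (simp add: \<rho>_def)
  have cut: "cutoff R y = a y ^ 4" for y by (simp add: cutoff_def a_def \<rho>_def)
  have aR: "a R = 0" using R by (simp add: a_def \<rho>_def)
  have cont: "continuous_on {0..R} g" "continuous_on {0..R} p"
    "continuous_on {0..R} h" "continuous_on {0..R} q" "continuous_on {0..R} a"
    using S'(1-4) by (auto intro: continuous_on_subset simp: a_def intro!: continuous_intros)
  define \<mu> where "\<mu> y = y ^ (N - 1)" for y :: real
  have [continuous_intros]: "continuous_on {0..R} \<mu>"
    unfolding \<mu>_def by (intro continuous_intros)
  define B where "B y = \<mu> y * (q y * g y * a y ^ 4
      - h y * (p y * a y ^ 4 - 8 * \<rho> * y * a y ^ 3 * g y)) + 1/8 * (y * \<mu> y * ((g y)\<^sup>2 * a y ^ 4))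
      - 512 * (\<mu> y * (p y * g y * (\<rho>\<^sup>2 * y\<^sup>2 * (a y)\<^sup>2)))" for y
  define E where "E y = ((\<beta> + real N / 8) * a y ^ 4 - \<rho> * y\<^sup>2 * a y ^ 3) * (g y)\<^sup>2
      - (h y)\<^sup>2 * a y ^ 4 + 16 * \<rho> * y * a y ^ 3 * (h y * p y)
      - h y * g y * (\<rho> * (a y)\<^sup>2 * (48 * \<rho> * y\<^sup>2 - 8 * real N * a y))
      - 512 * (h y * g y * (\<rho>\<^sup>2 * y\<^sup>2 * (a y)\<^sup>2) + (p y)\<^sup>2 * (\<rho>\<^sup>2 * y\<^sup>2 * (a y)\<^sup>2)
          + p y * g y * (2 * \<rho>\<^sup>2 * y * a y * (a y - 2 * \<rho> * y\<^sup>2)))" for y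
  have da: "(a has_real_derivative - 2 * \<rho> * y) (at y)" for y
    unfolding a_def by (auto intro!: derivative_eq_intros)
  have d\<mu>: "(\<mu> has_real_derivative (real N - 1) / y * \<mu> y) (at y)" if "y > 0" for y
    unfolding \<mu>_def using that N by (intro DERIV_radial_weight) auto
  have dB: "(B has_real_derivative \<mu> y * E y) (at y)" if "y > 0" for y
  proof -
    \<comment> \<open>With \<open>N = 1 + c y\<close> the identity becomes polynomial, free of division by \<open>y\<close>.\<close>
    define c where "c = (real N - 1) / y"
    have Nc: "real N = 1 + c * y" using that by (simp add: c_def)
    note d = S'(5)[OF that] S'(6)[OF that, folded c_def] S'(7)[OF that] S'(8)[OF that, folded c_def]
      da[of y] d\<mu>[OF that, folded c_def]
    show ?thesis
      unfolding B_def
      by (rule derivative_eq_intros d refl)+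
        (simp add: E_def Nc,
         simp add: algebra_simps power2_eq_square power3_eq_cube power4_eq_xxxx,
         simp add: field_simps)
  qed
  have "((\<lambda>y. \<mu> y * E y) has_integral (B R - B 0)) {0..R}"
  proof (rule fundamental_theorem_of_calculus_interior)
    show "continuous_on {0..R} B"
      unfolding B_def by (intro continuous_intros cont) auto
    show "(B has_vector_derivative \<mu> y * E y) (at y)" if "y \<in> {0<..<R}" for y
      using dB[of y] that by (simp add: has_real_derivative_iff_has_vector_derivative)
  qed (use R in auto)
  moreover have "B R = 0" "B 0 = 0" by (simp_all add: B_def aR) (use N in \<open>simp_all add: \<mu>_def\<close>)
  ultimately have int0: "integral {0..R} (\<lambda>y. \<mu> y * E y) = 0"
    by (simp add: integral_unique)
  define F where "F y = (\<beta> + real N / 8) * (\<mu> y * ((g y)\<^sup>2 * a y ^ 4))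
      - (\<mu> y * ((h y)\<^sup>2 * a y ^ 4)) / 4 + error_const N * \<rho>\<^sup>2 * (\<mu> y * (g y)\<^sup>2)" for y
  have i1: "(\<lambda>y. \<mu> y * ((g y)\<^sup>2 * a y ^ 4)) integrable_on {0..R}"
    and i2: "(\<lambda>y. \<mu> y * ((h y)\<^sup>2 * a y ^ 4)) integrable_on {0..R}"
    and i3: "(\<lambda>y. \<mu> y * (g y)\<^sup>2) integrable_on {0..R}"
    and i4: "(\<lambda>y. \<mu> y * E y) integrable_on {0..R}"
    unfolding E_def by (intro integrable_continuous_real continuous_intros cont; simp)+
  have Fint: "(F has_integral (\<beta> + real N / 8) * integral {0..R} (\<lambda>y. \<mu> y * ((g y)\<^sup>2 * a y ^ 4))
      - integral {0..R} (\<lambda>y. \<mu> y * ((h y)\<^sup>2 * a y ^ 4)) / 4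
      + error_const N * \<rho>\<^sup>2 * integral {0..R} (\<lambda>y. \<mu> y * (g y)\<^sup>2)) {0..R}"
    unfolding F_def
    by (intro has_integral_add has_integral_diff has_integral_mult_right has_integral_divide
        integrable_integral i1 i2 i3)
  have "0 \<le> integral {0..R} F"
  proof -
    have "\<mu> y * E y \<le> F y" if y: "y \<in> {0..R}" for y
    proof -
      have "y\<^sup>2 \<le> R\<^sup>2" using y by (simp add: power_mono)
      then have "\<rho> * y\<^sup>2 \<le> 1" using R by (simp add: \<rho>_def field_simps)
      then have "E y \<le> (\<beta> + real N / 8) * ((g y)\<^sup>2 * a y ^ 4) - (h y)\<^sup>2 * a y ^ 4 / 4
          + error_const N * \<rho>\<^sup>2 * (g y)\<^sup>2"
        unfolding E_def a_def using energy_pointwise[OF \<rho>] y by auto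
      then have "\<mu> y * E y \<le> \<mu> y * ((\<beta> + real N / 8) * ((g y)\<^sup>2 * a y ^ 4)
          - (h y)\<^sup>2 * a y ^ 4 / 4 + error_const N * \<rho>\<^sup>2 * (g y)\<^sup>2)"
        using y by (intro mult_left_mono) (auto simp: \<mu>_def)
      then show ?thesis by (simp add: F_def algebra_simps)
    qed
    then show ?thesis
      using integral_le[OF i4 has_integral_integrable[OF Fint]] int0 by simp
  qed
  moreover have "error_const N * \<rho>\<^sup>2 = error_const N / R ^ 4"
    by (simp add: \<rho>_def power_divide flip: power_mult)
  ultimately show ?thesis
    using integral_unique[OF Fint] by (simp only: cut mass_def \<mu>_def)
qed

section \<open>Consequences for solutions of polynomial growth\<close>

lemma mass_integrable:
  fixes g :: "real \<Rightarrow> real"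
  assumes "continuous_on {0..} g"
  shows "(\<lambda>y. y ^ (N - 1) * (g y)\<^sup>2) integrable_on {0..R}"
  by (intro integrable_continuous_real continuous_intros continuous_on_subset[OF assms]) auto

lemma mass_mono:
  assumes "continuous_on {0..} g" "r \<le> R"
  shows "mass N g r \<le> mass N g R"
  unfolding mass_def
  using assms by (intro integral_subset_le mass_integrable) auto

lemma mass_nonneg: "0 \<le> mass N g R"
  unfolding mass_def
  by (cases "(\<lambda>y. y ^ (N - 1) * (g y)\<^sup>2) integrable_on {0..R}")
     (auto intro!: integral_nonneg simp: not_integrable_integral)

lemma mass_half_le_cutoff:
  assumes g: "continuous_on {0..} g" and R: "R > 0"
  shows "mass N g (R / 2) \<le> 4 * integral {0..R} (\<lambda>y. y ^ (N - 1) * ((g y)\<^sup>2 * cutoff R y))"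
proof -
  have cont: "continuous_on {0..R} g" "continuous_on {0..R/2} g"
    using g by (auto intro: continuous_on_subset)
  have i: "(\<lambda>y. y ^ (N - 1) * ((g y)\<^sup>2 * cutoff R y)) integrable_on {0..R}"
    "(\<lambda>y. 4 * (y ^ (N - 1) * ((g y)\<^sup>2 * cutoff R y))) integrable_on {0..R/2}"
    "(\<lambda>y. 4 * (y ^ (N - 1) * ((g y)\<^sup>2 * cutoff R y))) integrable_on {0..R}"
    unfolding cutoff_def using R
    by (intro integrable_continuous_real continuous_intros cont; simp)+
  have "mass N g (R / 2) \<le> integral {0..R/2} (\<lambda>y. 4 * (y ^ (N - 1) * ((g y)\<^sup>2 * cutoff R y)))"
    unfolding mass_def
  proof (intro integral_le mass_integrable g i)
    fix y assume y: "y \<in> {0..R/2}"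
    have "y\<^sup>2 \<le> (R/2)\<^sup>2" using y by (intro power_mono) auto
    then have "y\<^sup>2 / R\<^sup>2 \<le> 1 / 4" using R by (simp add: field_simps power2_eq_square)
    then have "(3/4) ^ 4 \<le> (1 - y\<^sup>2 / R\<^sup>2) ^ 4" by (intro power_mono) auto
    moreover have "1 / 4 \<le> (3/4 :: real) ^ 4" by (simp add: power4_eq_xxxx)
    ultimately have "1 \<le> 4 * cutoff R y" unfolding cutoff_def by linarith
    then have "(y ^ (N - 1) * (g y)\<^sup>2) * 1 \<le> (y ^ (N - 1) * (g y)\<^sup>2) * (4 * cutoff R y)"
      using y by (intro mult_left_mono) auto
    then show "y ^ (N - 1) * (g y)\<^sup>2 \<le> 4 * (y ^ (N - 1) * ((g y)\<^sup>2 * cutoff R y))"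
      by (simp add: algebra_simps)
  qed
  also have "\<dots> \<le> integral {0..R} (\<lambda>y. 4 * (y ^ (N - 1) * ((g y)\<^sup>2 * cutoff R y)))"
    using R by (intro integral_subset_le i) (auto simp: cutoff_def)
  finally show ?thesis by simp
qed

lemma cutoff_le_mass:
  assumes g: "continuous_on {0..} g" and R: "R > 0"
  shows "integral {0..R} (\<lambda>y. y ^ (N - 1) * ((g y)\<^sup>2 * cutoff R y)) \<le> mass N g R"
  unfolding mass_def
proof (intro integral_le mass_integrable g)
  have cont: "continuous_on {0..R} g"
    using g by (auto intro: continuous_on_subset)
  show "(\<lambda>y. y ^ (N - 1) * ((g y)\<^sup>2 * cutoff R y)) integrable_on {0..R}"
    unfolding cutoff_def using R
    by (intro integrable_continuous_real continuous_intros cont; simp)+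
  fix y assume y: "y \<in> {0..R}"
  then have "y\<^sup>2 \<le> R\<^sup>2" by (intro power_mono) auto
  then have "cutoff R y \<le> 1" unfolding cutoff_def using R
    by (intro power_le_one) (auto simp: field_simps)
  then have "(y ^ (N - 1) * (g y)\<^sup>2) * cutoff R y \<le> (y ^ (N - 1) * (g y)\<^sup>2) * 1"
    using y by (intro mult_left_mono) auto
  then show "y ^ (N - 1) * ((g y)\<^sup>2 * cutoff R y) \<le> y ^ (N - 1) * (g y)\<^sup>2"
    by (simp add: algebra_simps)
qed

lemma error_const_pos: "error_const N > 0"
  by (simp add: error_const_def add_nonneg_pos)

text \<open>
  Growth is measured in mean square because this is the form that \<open>energy_estimate\<close> passes on from
  \<open>g\<close> to \<open>h\<close>; pointwise bounds on derivatives are never required.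
\<close>

definition tempered :: "nat \<Rightarrow> nat \<Rightarrow> (real \<Rightarrow> real) \<Rightarrow> bool" where
  "tempered N P g \<longleftrightarrow> (\<exists>A. \<forall>R\<ge>1. mass N g R \<le> A * R ^ P)"

text \<open>
  Whatever the sign of \<open>\<beta> + N/8\<close>, the right-hand side of \<open>energy_estimate\<close> at radius \<open>2R\<close> is at most
  a constant times the mass of \<open>g\<close> there.
\<close>

lemma tempered_laplacian:
  assumes S: "radial_system N \<beta> g p h q" and N: "N \<ge> 2" and g: "tempered N P g"
  shows "tempered N P h"
proof -
  note S' = radial_systemD[OF S]
  obtain A where A: "\<And>R. R \<ge> 1 \<Longrightarrow> mass N g R \<le> A * R ^ P"
    using g by (auto simp: tempered_def)
  define K where "K = 16 * (\<bar>\<beta>\<bar> + real N / 8 + error_const N)"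
  have K: "K \<ge> 0" using error_const_pos[of N] by (simp add: K_def)
  have "mass N h R \<le> (K * A * 2 ^ P) * R ^ P" if R: "R \<ge> 1" for R
  proof -
    let ?w = "integral {0..2*R} (\<lambda>y. y ^ (N - 1) * ((g y)\<^sup>2 * cutoff (2*R) y))"
    have w: "0 \<le> ?w" "?w \<le> mass N g (2*R)"
      using cutoff_le_mass[OF S'(1), of "2*R" N] mass_half_le_cutoff[OF S'(1), of "2*R" N]
        mass_nonneg[of N g R] R by auto
    have "(\<beta> + real N / 8) * ?w \<le> (\<bar>\<beta>\<bar> + real N / 8) * mass N g (2*R)"
      by (rule order_trans[OF mult_right_mono mult_left_mono]) (use w in auto)
    moreover have "error_const N / (2*R) ^ 4 * mass N g (2*R) \<le> error_const N * mass N g (2*R)"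
    proof (rule mult_right_mono)
      have "1 \<le> (2*R) ^ 4" using R by (intro one_le_power) auto
      then show "error_const N / (2*R) ^ 4 \<le> error_const N"
        using error_const_pos[of N] by (simp add: divide_le_eq)
    qed (rule mass_nonneg)
    ultimately have "mass N h R \<le> K * mass N g (2*R)"
      using energy_estimate[OF S N, of "2*R"] mass_half_le_cutoff[OF S'(3), of "2*R" N] R
      by (simp add: K_def algebra_simps)
    also have "\<dots> \<le> K * (A * (2*R) ^ P)"
      using R by (intro mult_left_mono A K) auto
    finally show ?thesis by (simp add: power_mult_distrib algebra_simps)
  qed
  then show ?thesis unfolding tempered_def by blast
qed

lemma mass_zero_imp_zero:
  assumes g: "continuous_on {0..} g" and M: "\<And>R. R \<ge> 1 \<Longrightarrow> mass N g R \<le> 0" and y: "y > 0"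
  shows "g y = 0"
proof -
  have "((\<lambda>y. y ^ (N - 1) * (g y)\<^sup>2) has_integral 0) (cbox 0 (max 1 y))"
    using integrable_integral[OF mass_integrable[OF g, of N "max 1 y"]]
      M[of "max 1 y"] mass_nonneg[of N g "max 1 y"]
    by (simp add: mass_def)
  then have "y ^ (N - 1) * (g y)\<^sup>2 = 0"
    using y by (intro has_integral_0_cbox_imp_0[of 0 "max 1 y" "\<lambda>y. y ^ (N - 1) * (g y)\<^sup>2" y])
      (auto intro!: continuous_intros continuous_on_subset[OF g])
  then show ?thesis using y by simp
qed

text \<open>
  With \<open>\<beta> + N/8 \<le> -1\<close> the energy inequality gains a factor \<open>R\<^bsup>-4\<^esup>\<close> each time the radius is doubled
  (\<open>improve\<close>).  Doing this \<open>j\<close> times bounds the mass by a multiple of \<open>R\<^bsup>P-4j\<^esup>\<close> (\<open>decay\<close>), which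
  tends to zero once \<open>4j > P\<close>, although the mass increases with \<open>R\<close>.
\<close>

lemma tempered_negative_imp_zero:
  assumes S: "radial_system N \<beta> g p h q" and N: "N \<ge> 2" and g: "tempered N P g"
    and \<beta>: "\<beta> + real N / 8 \<le> -1" and y: "y > 0"
  shows "g y = 0"
proof (rule mass_zero_imp_zero[OF radial_systemD(1)[OF S] _ y])
  note S' = radial_systemD[OF S]
  define K where "K = 4 * error_const N"
  have K: "K \<ge> 0" using error_const_pos[of N] by (simp add: K_def)
  have improve: "mass N g R * R ^ 4 \<le> K * mass N g (2*R)" if R: "R \<ge> 1" for R
  proof -
    let ?w = "integral {0..2*R} (\<lambda>y. y ^ (N - 1) * ((g y)\<^sup>2 * cutoff (2*R) y))"
    have w: "mass N g R \<le> 4 * ?w"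
      using mass_half_le_cutoff[OF S'(1), of "2*R" N] R by simp
    have "0 \<le> integral {0..2*R} (\<lambda>y. y ^ (N - 1) * ((h y)\<^sup>2 * cutoff (2*R) y))"
      using mass_half_le_cutoff[OF S'(3), of "2*R" N] mass_nonneg[of N h R] R by simp
    then have "0 \<le> (\<beta> + real N / 8) * ?w + error_const N / (2*R) ^ 4 * mass N g (2*R)"
      using energy_estimate[OF S N, of "2*R"] R by simp
    moreover have "(\<beta> + real N / 8) * ?w \<le> -1 * ?w"
      using w mass_nonneg[of N g R] by (intro mult_right_mono \<beta>) simp
    ultimately have "mass N g R \<le> 4 * (error_const N / (2*R) ^ 4 * mass N g (2*R))"
      using w by simp
    also have "\<dots> \<le> 4 * (error_const N / R ^ 4 * mass N g (2*R))"
      using R error_const_pos[of N] mass_nonneg[of N g "2*R"]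
      by (intro mult_left_mono mult_right_mono divide_left_mono power_mono) auto
    finally show ?thesis using R by (simp add: K_def field_simps)
  qed
  have decay: "\<exists>A. \<forall>R\<ge>1. mass N g R * R ^ (4 * j) \<le> A * R ^ P" for j
  proof (induction j)
    case 0
    then show ?case using g by (simp add: tempered_def)
  next
    case (Suc j)
    then obtain A where A: "\<And>R. R \<ge> 1 \<Longrightarrow> mass N g R * R ^ (4 * j) \<le> A * R ^ P" by blast
    have "mass N g R * R ^ (4 * Suc j) \<le> (K * A * 2 ^ P) * R ^ P" if R: "R \<ge> 1" for R
    proof -
      have "mass N g R * R ^ (4 * Suc j) = (mass N g R * R ^ 4) * R ^ (4 * j)"
        by (simp add: power_add algebra_simps)
      also have "\<dots> \<le> (K * mass N g (2*R)) * (2*R) ^ (4 * j)"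
        using R K mass_nonneg[of N g]
        by (intro mult_mono improve power_mono) auto
      also have "\<dots> \<le> K * (A * (2*R) ^ P)"
        using mult_left_mono[OF A[of "2*R"] K] R by (simp add: algebra_simps)
      finally show ?thesis by (simp add: power_mult_distrib algebra_simps)
    qed
    then show ?case by blast
  qed
  fix r :: real assume r: "r \<ge> 1"
  from decay[of "Suc P"] obtain A
    where A: "\<And>R. R \<ge> 1 \<Longrightarrow> mass N g R * R ^ (4 * Suc P) \<le> A * R ^ P" by blast
  have le: "mass N g r * R \<le> \<bar>A\<bar>" if R: "R \<ge> r" for R
  proof -
    have R1: "R \<ge> 1" using r R by simp
    have "(mass N g r * R) * R ^ P \<le> mass N g R * R ^ (4 * Suc P)"
    proof -
      have "R * R ^ P \<le> R ^ (4 * Suc P)"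
        using R1 power_increasing[of "Suc P" "4 * Suc P" R] by simp
      then have "mass N g r * (R * R ^ P) \<le> mass N g R * R ^ (4 * Suc P)"
        using R1 R by (intro mult_mono mass_mono S'(1) mass_nonneg) auto
      then show ?thesis by (simp add: algebra_simps)
    qed
    also have "\<dots> \<le> A * R ^ P" by (rule A[OF R1])
    also have "\<dots> \<le> \<bar>A\<bar> * R ^ P" using R1 by (intro mult_right_mono) auto
    finally show ?thesis using R1 by simp
  qed
  show "mass N g r \<le> 0"
  proof (rule ccontr)
    assume "\<not> mass N g r \<le> 0"
    then have pos: "mass N g r > 0" by simp
    have "mass N g r * (r + (\<bar>A\<bar> + 1) / mass N g r) \<le> \<bar>A\<bar>"
      using pos by (intro le) simp
    moreover have "mass N g r * ((\<bar>A\<bar> + 1) / mass N g r) = \<bar>A\<bar> + 1"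
      using pos by (simp add: field_simps)
    moreover have "mass N g r * r > 0" using pos r by simp
    ultimately show False by (simp only: distrib_left)
  qed
qed

lemma DERIV_vanishing_half_line:
  fixes u :: "real \<Rightarrow> real"
  assumes u: "\<And>s. s > 0 \<Longrightarrow> u s = 0" and y: "y > 0" and d: "(u has_real_derivative d) (at y)"
  shows "d = 0"
proof -
  have "\<forall>\<^sub>F s in nhds y. u s = 0"
    using eventually_nhds_in_open[of "{0<..}" y] y u by (auto elim!: eventually_mono)
  then have "((\<lambda>_. 0) has_real_derivative d) (at y)"
    using d DERIV_cong_ev[of y y u "\<lambda>_. 0" d d] by blast
  then show ?thesis using DERIV_unique DERIV_const by blast
qed

text \<open>
  The base of the descent.  If \<open>h\<close> vanishes, the system leaves only the first-order relation
  \<open>\<beta> g = y p / 4\<close>, so that \<open>g\<close> is a radial harmonic function homogeneous of degree \<open>4\<beta>\<close>; the only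
  ones that are regular at the origin are the constants.
\<close>

lemma harmonic_imp_eigenvalue_zero:
  assumes S: "radial_system N \<beta> g p h q" and N: "N \<ge> 2"
    and h: "\<And>y. y > 0 \<Longrightarrow> h y = 0" and g: "y0 > 0" "g y0 \<noteq> 0"
  shows "\<beta> = 0"
proof -
  note S' = radial_systemD[OF S]
  have q: "q y = 0" if "y > 0" for y
    using DERIV_vanishing_half_line[OF h that S'(7)[OF that]] .
  have eq: "\<beta> * g y = y / 4 * p y" if "y > 0" for y
    using DERIV_vanishing_half_line[OF q that S'(8)[OF that]] q[OF that] by simp
  \<comment> \<open>As \<open>h\<close> vanishes, \<open>y\<^bsup>N-1\<^esup> p\<close> is constant; it is \<open>0\<close> at the origin because \<open>p\<close> is continuous
    there and \<open>N \<ge> 2\<close>.  This discards the singular harmonic function.\<close>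
  have "y0 ^ (N - 1) * p y0 = 0 ^ (N - 1) * p 0"
  proof (rule DERIV_isconst2[of 0 y0])
    show "continuous_on {0..y0} (\<lambda>y. y ^ (N - 1) * p y)"
      by (intro continuous_intros continuous_on_subset[OF S'(2)]) auto
    show "((\<lambda>y. y ^ (N - 1) * p y) has_real_derivative 0) (at y)" if "0 < y" "y < y0" for y
      using that h[of y] N
      by (intro DERIV_cong[OF DERIV_mult[OF DERIV_radial_weight S'(6)]]) (auto simp: field_simps)
  qed (use g in auto)
  then have "p y0 = 0" using g N by (simp add: zero_power)
  then show ?thesis using eq[OF g(1)] g by simp
qed

text \<open>
  The induction is on a bound for the number of times that \<open>\<Delta>\<close> can be applied before \<open>\<beta> + N/8\<close>
  drops to \<open>-1\<close>, where only the zero solution remains.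
\<close>

lemma tempered_eigenvalue:
  assumes "radial_system N \<beta> g p h q" and N: "N \<ge> 2" and "tempered N P g"
    and "y0 > 0" "g y0 \<noteq> 0"
  shows "\<exists>k::nat. \<beta> = real k / 2"
proof -
  obtain m :: nat where "2 * (\<beta> + real N / 8 + 1) \<le> real m" using real_arch_simple by blast
  then have "\<beta> + real N / 8 + 1 \<le> real m / 2" by simp
  then show ?thesis
    using assms
  proof (induction m arbitrary: \<beta> g p h q y0)
    case 0
    then show ?case using tempered_negative_imp_zero[of N \<beta> g p h q P y0] by simp
  next
    case (Suc m)
    show ?case
    proof (cases "\<forall>y>0. h y = 0")
      case True
      then have "\<beta> = 0"
        using harmonic_imp_eigenvalue_zero[of N \<beta> g p h q y0] Suc.prems by blast
      then show ?thesis by (intro exI[of _ 0]) simp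
    next
      case False
      then obtain y1 where y1: "y1 > 0" "h y1 \<noteq> 0" by blast
      have "\<beta> - 1/2 + real N / 8 + 1 \<le> real m / 2" using Suc.prems(1) by simp
      from Suc.IH[OF this radial_system_laplacian[OF Suc.prems(2)] N
          tempered_laplacian[OF Suc.prems(2) N Suc.prems(4)] y1]
      obtain k :: nat where "\<beta> - 1/2 = real k / 2" by blast
      then show ?thesis by (intro exI[of _ "Suc k"]) simp
    qed
  qed
qed

section \<open>Admissible profiles as solutions of the system\<close>

lemma radial_laplacian_eq:
  assumes N: "N \<ge> 1" and y: "y > 0"
    and g: "\<And>s. s > 0 \<Longrightarrow> (g has_real_derivative p s) (at s)"
    and p: "(p has_real_derivative p') (at y)"
  shows "radial_laplacian N g y = p' + (real N - 1) / y * p y"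
proof -
  have *: "((\<lambda>s. s ^ (N - 1) * p s) has_real_derivative
      y ^ (N - 1) * (p' + (real N - 1) / y * p y)) (at y)"
    using y N p
    by (intro DERIV_cong[OF DERIV_mult[OF DERIV_radial_weight p]]) (auto simp: field_simps)
  have ev: "\<forall>\<^sub>F s in nhds y. s ^ (N - 1) * deriv g s = s ^ (N - 1) * p s"
    using eventually_nhds_in_open[of "{0<..}" y] y
    by (auto elim!: eventually_mono simp: DERIV_imp_deriv[OF g])
  have "((\<lambda>s. s ^ (N - 1) * deriv g s) has_real_derivative
      y ^ (N - 1) * (p' + (real N - 1) / y * p y)) (at y)"
    by (rule DERIV_cong_ev[THEN iffD2, OF refl ev refl *])
  then show ?thesis
    unfolding radial_laplacian_def using y by (simp add: DERIV_imp_deriv)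
qed

lemma continuous_on_half_line_extend:
  fixes u :: "real \<Rightarrow> real"
  assumes "\<And>y. y > 0 \<Longrightarrow> isCont u y" and "(u \<longlongrightarrow> l) (at_right 0)"
  shows "continuous_on {0..} (\<lambda>y. if y = 0 then l else u y)"
  unfolding continuous_on
proof
  fix y :: real assume "y \<in> {0..}"
  then consider "y = 0" | "y > 0" by force
  then show "((\<lambda>y. if y = 0 then l else u y) \<longlongrightarrow> (if y = 0 then l else u y)) (at y within {0..})"
  proof cases
    case 1
    have "\<forall>\<^sub>F x in at_right 0. (if x = 0 then l else u x) = u x"
      by (auto simp: eventually_at_filter)
    then have "((\<lambda>y. if y = 0 then l else u y) \<longlongrightarrow> l) (at_right 0)"
      using assms(2) by (simp add: tendsto_cong)
    moreover have "at_right 0 = at (0::real) within {0..}"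
      by (rule at_within_nhd[of _ UNIV]) auto
    ultimately show ?thesis using 1 by simp
  next
    case 2
    have "\<forall>\<^sub>F x in at y. (if x = 0 then l else u x) = u x"
      using 2 by (intro eventually_mono[OF eventually_at_ball[of y]]) (auto simp: dist_real_def)
    then have "((\<lambda>y. if y = 0 then l else u y) \<longlongrightarrow> u y) (at y)"
      using assms(1)[OF 2] by (simp add: tendsto_cong isCont_def)
    then show ?thesis using 2 by (auto intro: tendsto_within_subset)
  qed
qed

text \<open>
  For \<open>y > 0\<close> one has \<open>\<Delta> f = f'' + (N-1) f' / y\<close>.  The conditions \<open>f'(0) = f'''(0) = 0\<close> make this
  function and its derivative extend continuously to \<open>y = 0\<close>, with values \<open>N f''(0)\<close>
  and \<open>0\<close>.
\<close>

lemma radial_system_of_profile: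
  assumes N: "N \<ge> 2" and f: "smooth_half_line f"
    and f1: "half_line_deriv f 0 = 0" and f3: "(half_line_deriv ^^ 3) f 0 = 0"
    and ode: "focusing_ode N \<alpha> f"
  shows "\<exists>p h q. radial_system N \<alpha> f p h q"
proof -
  define D where "D k = (half_line_deriv ^^ k) f" for k
  have D0: "D 0 = f" by (simp add: D_def)
  have Dw: "(D k has_real_derivative D (Suc k) y) (at y within {0..})" if "y \<ge> 0" for k y
    using f that
    unfolding smooth_half_line_def D_def differentiable_on_def has_real_derivative_iff_has_vector_derivative
    by (auto simp: half_line_deriv_def vector_derivative_works[symmetric])
  have D: "(D k has_real_derivative D (Suc k) y) (at y)" if "y > 0" for k y
    using Dw[of y k] that at_within_interior[of y "{0..}"] by simp
  have Dc: "continuous_on {0..} (D k)" for k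
    using Dw by (auto intro!: DERIV_continuous_on)
  have D1: "D 1 0 = 0" and D3: "D 3 0 = 0" using f1 f3 by (simp_all add: D_def)
  define r where "r y = D 2 y + (real N - 1) * (D 1 y / y)" for y
  define s where "s y = D 3 y + (real N - 1) * (D 2 y / y - D 1 y / y\<^sup>2)" for y
  define h where "h y = (if y = 0 then D 2 0 + (real N - 1) * D 2 0 else r y)" for y
  define q where "q y = (if y = 0 then D 3 0 + (real N - 1) * 0 else s y)" for y
  have nums: "Suc (Suc 0) = 2" "Suc 2 = 3" "Suc 3 = 4" "Suc 1 = 2" by simp_all
  have dr: "(r has_real_derivative s y) (at y)" if "y > 0" for y
    unfolding r_def s_def using that D[OF that, of 1] D[OF that, of 2]
    by (auto intro!: derivative_eq_intros simp: nums power2_eq_square field_simps)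
  define s' where "s' y = D 4 y + (real N - 1) * (D 3 y / y - D 2 y / y\<^sup>2
      - (D 2 y / y\<^sup>2 - 2 * D 1 y / y ^ 3))" for y
  have ds: "(s has_real_derivative s' y) (at y)" if "y > 0" for y
    unfolding s_def s'_def using that D[OF that, of 1] D[OF that, of 2] D[OF that, of 3]
    by (auto intro!: derivative_eq_intros simp: nums power2_eq_square power3_eq_cube field_simps)
  have lap: "radial_laplacian N f y = r y" if "y > 0" for y
    using radial_laplacian_eq[of N y f "D 1" "D 2 y"] N that D[of _ 0] D[of _ 1]
    by (simp add: D0 r_def nums)
  have ev: "\<forall>\<^sub>F x in nhds y. x > 0" if "y > 0" for y :: real
    using eventually_nhds_in_open[of "{0<..}" y] that by simp
  have dlap: "(radial_laplacian N f has_real_derivative s y) (at y)" if "y > 0" for y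
    using dr[OF that] DERIV_cong_ev[OF refl eventually_mono[OF ev[OF that]] refl] lap by metis
  have lap2: "radial_laplacian N (radial_laplacian N f) y = s' y + (real N - 1) / y * s y"
    if "y > 0" for y
    using radial_laplacian_eq[of N y "radial_laplacian N f" s "s' y"] N that dlap ds by simp
  have s'_eq: "s' y = \<alpha> * f y - y / 4 * D 1 y - (real N - 1) / y * s y" if "y > 0" for y
  proof -
    have "deriv f y = D 1 y" using D[OF that, of 0] by (simp add: D0 DERIV_imp_deriv)
    then show ?thesis using ode that lap2[OF that] unfolding focusing_ode_def by force
  qed
  have at0: "at_right 0 = at (0::real) within {0..}"
    by (rule at_within_nhd[of _ UNIV]) auto
  have Dr: "(D k \<longlongrightarrow> D k 0) (at_right 0)" for k
    using Dc[of k] unfolding continuous_on at0 by simp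
  have Dq: "((\<lambda>y. (D k y - D k 0) / y) \<longlongrightarrow> D (Suc k) 0) (at_right 0)" for k
    using Dw[of 0 k] unfolding at0 has_field_derivative_iff by simp
  have q1: "((\<lambda>y. D 1 y / y) \<longlongrightarrow> D 2 0) (at_right 0)"
    using Dq[of 1] D1 by (simp add: nums)
  have q2: "((\<lambda>y. (D 2 y - D 2 0) / y) \<longlongrightarrow> 0) (at_right 0)"
    using Dq[of 2] D3 by (simp add: nums)
  \<comment> \<open>By l'Hopital; together with \<open>q2\<close> it shows that \<open>(f'/y)'\<close> tends to \<open>0\<close>.\<close>
  have q3: "((\<lambda>y. (D 1 y - D 2 0 * y) / y\<^sup>2) \<longlongrightarrow> 0) (at_right 0)"
  proof (rule lhopital_right_0)
    show "((\<lambda>y. D 1 y - D 2 0 * y) \<longlongrightarrow> 0) (at_right 0)"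
      by (rule tendsto_eq_intros Dr refl)+ (simp add: D1[simplified])
    show "((\<lambda>y::real. y\<^sup>2) \<longlongrightarrow> 0) (at_right 0)"
      by (rule tendsto_eq_intros refl)+ simp
    show "\<forall>\<^sub>F y in at_right 0. (y::real)\<^sup>2 \<noteq> 0" "\<forall>\<^sub>F y in at_right 0. 2 * (y::real) \<noteq> 0"
      by (auto simp: eventually_at_filter)
    show "\<forall>\<^sub>F y in at_right 0. ((\<lambda>y. D 1 y - D 2 0 * y) has_real_derivative D 2 y - D 2 0) (at y)"
      using eventually_at_right_less[of 0]
      by eventually_elim (use D[of _ 1] in \<open>auto intro!: derivative_eq_intros simp: nums\<close>)
    show "\<forall>\<^sub>F y::real in at_right 0. ((\<lambda>y. y\<^sup>2) has_real_derivative 2 * y) (at y)"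
      by (intro always_eventually allI) (auto intro!: derivative_eq_intros)
    show "((\<lambda>y. (D 2 y - D 2 0) / (2 * y)) \<longlongrightarrow> 0) (at_right 0)"
      using tendsto_divide[OF q2 tendsto_const[of 2]] by (simp add: mult.commute)
  qed
  have q4: "((\<lambda>y. D 2 y / y - D 1 y / y\<^sup>2) \<longlongrightarrow> 0) (at_right 0)"
  proof (rule Lim_transform_eventually)
    show "((\<lambda>y. (D 2 y - D 2 0) / y - (D 1 y - D 2 0 * y) / y\<^sup>2) \<longlongrightarrow> 0) (at_right 0)"
      using tendsto_diff[OF q2 q3] by simp
    show "\<forall>\<^sub>F y in at_right 0. (D 2 y - D 2 0) / y - (D 1 y - D 2 0 * y) / y\<^sup>2
        = D 2 y / y - D 1 y / y\<^sup>2"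
      using eventually_at_right_less[of 0]
      by eventually_elim (simp add: field_simps power2_eq_square)
  qed
  have ch: "continuous_on {0..} h"
    unfolding h_def
  proof (rule continuous_on_half_line_extend)
    show "(r \<longlongrightarrow> D 2 0 + (real N - 1) * D 2 0) (at_right 0)"
      unfolding r_def by (intro tendsto_intros Dr q1)
  qed (rule DERIV_isCont[OF dr])
  have cq: "continuous_on {0..} q"
    unfolding q_def
  proof (rule continuous_on_half_line_extend)
    show "(s \<longlongrightarrow> D 3 0 + (real N - 1) * 0) (at_right 0)"
      unfolding s_def by (intro tendsto_add tendsto_mult tendsto_const Dr q4)
  qed (rule DERIV_isCont[OF ds])
  have dh: "(h has_real_derivative q y) (at y)" if "y > 0" for y
  proof -
    have *: "\<forall>\<^sub>F x in nhds y. h x = r x" by (rule eventually_mono[OF ev[OF that]]) (simp add: h_def)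
    show ?thesis using DERIV_cong_ev[THEN iffD2, OF refl * refl dr[OF that]] that by (simp add: q_def)
  qed
  have dq: "(q has_real_derivative s' y) (at y)" if "y > 0" for y
  proof -
    have *: "\<forall>\<^sub>F x in nhds y. q x = s x" by (rule eventually_mono[OF ev[OF that]]) (simp add: q_def)
    show ?thesis by (rule DERIV_cong_ev[THEN iffD2, OF refl * refl ds[OF that]])
  qed
  have "radial_system N \<alpha> f (D 1) h q"
    unfolding radial_system_def
  proof (intro conjI allI impI)
    show "continuous_on {0..} f" using Dc[of 0] by (simp add: D0)
    fix y :: real assume y: "y > 0"
    show "(f has_real_derivative D 1 y) (at y)" using D[OF y, of 0] by (simp add: D0)
    have "h y - (real N - 1) / y * D 1 y = D 2 y" using y by (simp add: h_def r_def)
    then show "(D 1 has_real_derivative h y - (real N - 1) / y * D 1 y) (at y)"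
      using D[OF y, of 1] by (simp add: nums)
    have "s' y = \<alpha> * f y - y / 4 * D 1 y - (real N - 1) / y * q y"
      using s'_eq[OF y] y by (simp add: q_def)
    then show "(q has_real_derivative \<alpha> * f y - y / 4 * D 1 y - (real N - 1) / y * q y) (at y)"
      using dq[OF y] by simp
  qed (use Dc ch cq dh in auto)
  then show ?thesis by blast
qed

text \<open>
  The exponential term is bounded because \<open>a3 < 0\<close>, so \<open>f = O(y\<^sup>k)\<close> at infinity for any natural number
  \<open>k \<ge> 4\<alpha>\<close>, and the mass in the ball of radius \<open>R\<close> is \<open>O(R\<^bsup>N+2k\<^esup>)\<close>.
\<close>

lemma tempered_of_minimal_growth:
  assumes cont: "continuous_on {0..} f" and f: "minimal_growth \<alpha> f" and N: "N \<ge> 1"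
  shows "\<exists>P. tempered N P f"
proof -
  obtain C D \<epsilon> \<delta> where \<epsilon>: "(\<epsilon> \<longlongrightarrow> (0::real)) at_top" and \<delta>: "(\<delta> \<longlongrightarrow> (0::real)) at_top"
    and eq: "\<forall>\<^sub>F y in at_top. f y = C * y powr (4 * \<alpha>) * (1 + \<epsilon> y)
        + D * exp (a3 * y powr (4/3)) * (1 + \<delta> y)"
    using f unfolding minimal_growth_def by blast
  obtain k :: nat where k: "4 * \<alpha> \<le> real k" using real_arch_simple by blast
  have "\<forall>\<^sub>F y in at_top. \<bar>\<epsilon> y\<bar> < 1" "\<forall>\<^sub>F y in at_top. \<bar>\<delta> y\<bar> < 1"
    using tendstoD[OF \<epsilon>, of 1] tendstoD[OF \<delta>, of 1] by (simp_all add: dist_real_def)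
  then have "\<forall>\<^sub>F y in at_top. \<bar>f y\<bar> \<le> 2 * (\<bar>C\<bar> + \<bar>D\<bar>) * y ^ k"
    using eq eventually_ge_at_top[of 1]
  proof eventually_elim
    case (elim y)
    have p: "y powr (4 * \<alpha>) \<le> y ^ k"
      using powr_mono[OF k, of y] elim(4) by (simp add: powr_realpow)
    have e: "exp (a3 * y powr (4/3)) \<le> y ^ k"
    proof -
      have "a3 * y powr (4/3) \<le> 0" by (simp add: a3_def)
      then have "exp (a3 * y powr (4/3)) \<le> 1" by simp
      also have "1 \<le> y ^ k" using elim(4) by simp
      finally show ?thesis .
    qed
    have "\<bar>C * y powr (4 * \<alpha>) * (1 + \<epsilon> y)\<bar> \<le> \<bar>C\<bar> * y ^ k * 2"
      unfolding abs_mult using elim p by (intro mult_mono) auto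
    moreover have "\<bar>D * exp (a3 * y powr (4/3)) * (1 + \<delta> y)\<bar> \<le> \<bar>D\<bar> * y ^ k * 2"
      unfolding abs_mult using elim e by (intro mult_mono) auto
    ultimately show ?case unfolding elim(3) by (simp add: algebra_simps)
  qed
  then obtain y0 where y0: "\<And>y. y \<ge> y0 \<Longrightarrow> \<bar>f y\<bar> \<le> 2 * (\<bar>C\<bar> + \<bar>D\<bar>) * y ^ k"
    by (auto simp: eventually_at_top_linorder)
  have "compact (f ` {0..y0})"
    by (intro compact_continuous_image continuous_on_subset[OF cont]) auto
  then obtain B where B: "\<And>y. y \<in> {0..y0} \<Longrightarrow> \<bar>f y\<bar> \<le> B"
    using compact_imp_bounded bounded_iff by (metis imageI real_norm_def)
  define A where "A = 2 * (\<bar>C\<bar> + \<bar>D\<bar>) + \<bar>B\<bar>"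
  have bound: "\<bar>f y\<bar> \<le> A * R ^ k" if R: "R \<ge> 1" and y: "0 \<le> y" "y \<le> R" for y R
  proof -
    have R1: "1 \<le> R ^ k" using R by simp
    show ?thesis
    proof (cases "y \<le> y0")
      case True
      have "\<bar>f y\<bar> \<le> \<bar>B\<bar> * 1" using B[of y] y True by simp
      also have "\<dots> \<le> A * R ^ k" using R1 by (intro mult_mono) (auto simp: A_def)
      finally show ?thesis .
    next
      case False
      have "\<bar>f y\<bar> \<le> 2 * (\<bar>C\<bar> + \<bar>D\<bar>) * y ^ k" using y0[of y] False by simp
      also have "\<dots> \<le> A * R ^ k" using y R by (intro mult_mono power_mono) (auto simp: A_def)
      finally show ?thesis .
    qed
  qed
  have "mass N f R \<le> A\<^sup>2 * R ^ (N + 2 * k)" if R: "R \<ge> 1" for R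
  proof -
    have "mass N f R \<le> integral {0..R} (\<lambda>_. R ^ (N - 1) * (A * R ^ k)\<^sup>2)"
      unfolding mass_def
    proof (rule integral_le[OF mass_integrable[OF cont]])
      fix y assume y: "y \<in> {0..R}"
      have sq: "(f y)\<^sup>2 \<le> (A * R ^ k)\<^sup>2"
        using power_mono[OF bound[OF R, of y], of 2] y by simp
      then show "y ^ (N - 1) * (f y)\<^sup>2 \<le> R ^ (N - 1) * (A * R ^ k)\<^sup>2"
        using y R by (intro mult_mono sq) (auto intro!: power_mono)
    qed auto
    also have "\<dots> = A\<^sup>2 * (R * R ^ (N - 1) * (R ^ k)\<^sup>2)"
      using R by (simp add: power_mult_distrib algebra_simps)
    also have "R * R ^ (N - 1) * (R ^ k)\<^sup>2 = R ^ (N + 2 * k)"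
      using N by (simp add: power_add power_mult[symmetric] mult.commute flip: power_Suc)
    finally show ?thesis .
  qed
  then show ?thesis unfolding tempered_def by blast
qed

theorem proposition4p1:
  fixes N :: nat
  assumes "N \<ge> 2"
  shows "countable {\<alpha>. admissible_eigenvalue N \<alpha>} \<and>
         {\<alpha>. admissible_eigenvalue N \<alpha>} \<subseteq> {real k / 2 |k::nat. k \<ge> 1}"
proof -
  have "\<exists>k::nat. \<alpha> = real k / 2 \<and> k \<ge> 1" if \<alpha>: "admissible_eigenvalue N \<alpha>" for \<alpha>
  proof -
    obtain f y0 where pos: "\<alpha> > 0" and f: "smooth_half_line f" "half_line_deriv f 0 = 0"
      "(half_line_deriv ^^ 3) f 0 = 0" "focusing_ode N \<alpha> f" "minimal_growth \<alpha> f"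
      and y0: "y0 > 0" "f y0 \<noteq> 0"
      using \<alpha> unfolding admissible_eigenvalue_def by blast
    obtain p h q where S: "radial_system N \<alpha> f p h q"
      using radial_system_of_profile[OF assms f(1-4)] by blast
    obtain P where "tempered N P f"
      using tempered_of_minimal_growth[OF radial_systemD(1)[OF S] f(5)] assms by force
    then obtain k :: nat where k: "\<alpha> = real k / 2"
      using tempered_eigenvalue[OF S assms _ y0] by blast
    with pos have "k \<ge> 1" by (cases k) auto
    with k show ?thesis by blast
  qed
  then have sub: "{\<alpha>. admissible_eigenvalue N \<alpha>} \<subseteq> {real k / 2 |k::nat. k \<ge> 1}" by blast
  have "countable ((\<lambda>k::nat. real k / 2) ` UNIV)" by simp
  then have "countable {\<alpha>. admissible_eigenvalue N \<alpha>}"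
    by (rule countable_subset[rotated]) (use sub in auto)
  with sub show ?thesis by blast
qed

end
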